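(* $$\pi^2\, m\big((1+w)(1+y)+(1-w)(x-y)\big)=2\,\mathcal{L}^1_3(1)+\frac{\pi^2}{2}\log 2,$$ where the polynomial is in the three variables $w,x,y$ and $\mathcal{L}^1_3(1)=\mathrm{Li}_3(1)-\mathrm{Li}_3(-1)$.
   Context: The (logarithmic) Mahler measure of a nonzero polynomial $P\in\mathbb{C}[x_1,\dots,x_n]$ is $m(P)=\frac{1}{(2\pi i)^n}\int_{\mathbb{T}^n}\log|P(x_1,\dots,x_n)|\,\frac{dx_1}{x_1}\cdots\frac{dx_n}{x_n}$, with $\mathbb{T}^n=\{|x_1|=\dots=|x_n|=1\}$. $\mathrm{Li}_3(x)=\sum_{k\ge1}x^k/k^3$ for $|x|\le1$. *)

theory Defs
  imports "HOL-Analysis.Analysis" "HOL-Library.Poly_Mapping"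
begin

(* Polynomials over the complex numbers in CARD('n) variables, as finitely supported maps
   from exponent vectors to coefficients; the ring structure is that of Poly_Mapping. *)
type_synonym 'n cpoly = "('n \<Rightarrow>\<^sub>0 nat) \<Rightarrow>\<^sub>0 complex"

definition var :: "'n \<Rightarrow> 'n cpoly" where
  "var i = Poly_Mapping.single (Poly_Mapping.single i 1) 1"

definition eval_cpoly :: "'n::finite cpoly \<Rightarrow> ('n \<Rightarrow> complex) \<Rightarrow> complex" where
  "eval_cpoly P x = (\<Sum>m\<in>Poly_Mapping.keys P. Poly_Mapping.lookup P m * (\<Prod>i\<in>UNIV. x i ^ Poly_Mapping.lookup m i))"

(* The torus is parametrized by x_j = cis (t_j) with 0 <= t_j <= 2 pi, so that
   dx_j / (2 pi i x_j) = dt_j / (2 pi).  The convention ln 0 = 0 is harmless for P \<noteq> 0,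
   since the zeros of P on the torus then form a null set. *)
definition mahler_measure :: "'n::finite cpoly \<Rightarrow> real" where
  "mahler_measure P = 1 / (2 * pi) ^ CARD('n) *
     (LINT t | (\<Pi>\<^sub>M j\<in>UNIV. restrict_space lborel {0..2 * pi}).
        ln (cmod (eval_cpoly P (\<lambda>j. cis (t j)))))"

definition Li3 :: "'a::{real_normed_field, banach} \<Rightarrow> 'a" where
  "Li3 x = suminf (\<lambda>k. x ^ Suc k / of_nat (Suc k) ^ 3)"

(* The value at 1 of the function written as a calligraphic L with indices 3 and 1;
   only this value is needed. *)
definition cal_L31_at_1 :: real where
  "cal_L31_at_1 = Li3 1 - Li3 (- 1)"

end

theory Submission
  imports Defs "HOL-Complex_Analysis.Complex_Analysis"
begin

text \<open>On the torus write \<open>w = cis u\<close> and \<open>x = cis v\<close>.  Expanded, the polynomial is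
  \<open>(1 + w + (1 - w) x) + 2 w y\<close>, linear in \<open>y\<close>.  Jensen's formula (\<open>Jensen_linear\<close>) integrates
  \<open>y\<close> out and leaves the mean of \<open>ln (max 2 r)\<close> with \<open>r = |1 + w + (1 - w) x|\<close>.  Since
  \<open>|1 + w|\<^sup>2 + |1 - w|\<^sup>2 = 4\<close>, the modulus has the simple form \<open>r\<^sup>2 = 4 (1 + sin u sin v)\<close>
  (\<open>norm_y_free_part\<close>), so the Mahler measure is \<open>ln 2\<close> plus half the mean of
  \<open>ln (1 + max 0 (sin u sin v))\<close>.  By symmetry this mean is \<open>K / (2 pi\<^sup>2)\<close>, where \<open>K\<close> is the integral of
  \<open>ln (1 + cos b cos v)\<close> over the square \<open>[-pi/2, pi/2]\<^sup>2\<close>.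

  To evaluate \<open>K\<close>, integrate by parts in \<open>b\<close>; the integral over \<open>v\<close> of the resulting rational
  function of \<open>cos v\<close> is elementary (\<open>log_derivative_has_integral\<close>), and \<open>K\<close> becomes the integral of
  \<open>b (pi sin b - 2 b) / cos b\<close>.  In the variable \<open>u = b + pi/2\<close>, and after reflecting one of two
  terms, this is twice the integral of \<open>u (pi/2 - u) cot (u/2)\<close> over \<open>[0, pi]\<close>.

  Formally \<open>cot (u/2) = 2 (sin u + sin 2u + sin 3u + \<dots>)\<close>, and integrating \<open>u (pi/2 - u)\<close> against
  \<open>sin n u\<close> gives \<open>pi\<^sup>2/2 (-1)\<^sup>n / n + 2 (1 - (-1)\<^sup>n) / n\<^sup>3\<close>.  Summing over \<open>n\<close>, the first part
  yields \<open>ln 2\<close> and the second \<open>Li\<^sub>3(1) - Li\<^sub>3(-1)\<close>; the exact identity \<open>conjugate_Dirichlet_sum\<close> and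
  a Cesaro argument justify the expansion (\<open>quad_cot_has_integral\<close>).  The result is
  \<open>K = 8 (Li\<^sub>3(1) - Li\<^sub>3(-1)) - 2 pi\<^sup>2 ln 2\<close>.\<close>

section \<open>Jensen's formula for a linear polynomial\<close>

text \<open>For \<open>|z| < 1\<close> the values \<open>1 + z w\<close>, \<open>|w| \<le> 1\<close>, stay off the branch cut of \<^term>\<open>Ln\<close>; hence
  \<open>w \<mapsto> Ln (1 + z w)\<close> is holomorphic on the closed disc and its mean over the unit circle is its
  value \<open>0\<close> at the centre.  The integrand below is its real part.\<close>

lemma ln_norm_one_plus_mean_zero:
  fixes z :: complex
  assumes "norm z < 1"
  shows "((\<lambda>t. ln (norm (1 + z * cis t))) has_integral 0) {0..2 * pi}"
proof -
  have pos: "1 + z * w \<notin> \<real>\<^sub>\<le>\<^sub>0" if "w \<in> cball 0 1" for w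
  proof
    assume "1 + z * w \<in> \<real>\<^sub>\<le>\<^sub>0"
    then have "Re (z * w) \<le> -1" by (auto simp: complex_nonpos_Reals_iff)
    then have "1 \<le> norm (z * w)" using abs_Re_le_cmod[of "z * w"] by linarith
    also have "\<dots> \<le> norm z" using that by (simp add: norm_mult mult_left_le)
    finally show False using assms by simp
  qed
  have "(\<lambda>w. Ln (1 + z * w)) holomorphic_on cball 0 1"
    by (intro holomorphic_intros) (use pos in auto)
  from Cauchy_integral_circlepath_simple[OF this, of 0]
  have "((\<lambda>w. Ln (1 + z * w) / w) has_contour_integral 0) (circlepath 0 1)"
    by simp
  then have "((\<lambda>t. Ln (1 + z * cis t) * \<i>) has_integral 0) {0..2 * pi}"
    by (simp add: circlepath_def has_contour_integral_part_circlepath_iff)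
  from has_integral_mult_left[OF this, of "- \<i>"]
  have "((\<lambda>t. Ln (1 + z * cis t)) has_integral 0) {0..2 * pi}"
    by (simp add: mult.assoc)
  from has_integral_Re[OF this]
  have "((\<lambda>t. Re (Ln (1 + z * cis t))) has_integral 0) {0..2 * pi}" by simp
  moreover have "Re (Ln (1 + z * cis t)) = ln (norm (1 + z * cis t))" for t
  proof -
    have "1 + z * cis t \<noteq> 0" using pos[of "cis t"] by force
    then show ?thesis by simp
  qed
  ultimately show ?thesis by simp
qed

text \<open>After dividing by the larger coefficient, \<^prop>\<open>norm (a::complex) \<noteq> norm b\<close> leaves a factor
  of the form handled above.  If \<open>b\<close> dominates, conjugating the factor turns \<open>cis (- t)\<close> back
  into \<open>cis t\<close>.\<close>

lemma Jensen_linear: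
  fixes a b :: complex
  assumes "norm a \<noteq> norm b"
  shows "((\<lambda>t. ln (norm (a + b * cis t))) has_integral 2 * pi * ln (max (norm a) (norm b))) {0..2 * pi}"
proof -
  have *: "((\<lambda>t. ln (norm c) + ln (norm (1 + z * cis t))) has_integral 2 * pi * ln (norm c)) {0..2 * pi}"
    if "norm z < 1" for c z :: complex
  proof -
    have "((\<lambda>t::real. ln (norm c)) has_integral 2 * pi * ln (norm c)) {0..2 * pi}"
      using has_integral_const_real[of "ln (norm c)" 0 "2 * pi"] by simp
    from has_integral_add[OF this ln_norm_one_plus_mean_zero[OF that]] show ?thesis by simp
  qed
  have nz: "1 + z * cis t \<noteq> 0" if "norm z < 1" for z t
  proof
    assume "1 + z * cis t = 0"
    then have "norm (z * cis t) = 1" by (metis add_eq_0_iff norm_minus_cancel norm_one)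
    with that show False by (simp add: norm_mult)
  qed
  show ?thesis
  proof (cases "norm b < norm a")
    case True
    have "norm (b / a) < 1" using True by (auto simp: norm_divide divide_simps)
    moreover have "ln (norm (a + b * cis t)) = ln (norm a) + ln (norm (1 + b / a * cis t))" for t
    proof -
      have "a \<noteq> 0" using True by auto
      then have "a + b * cis t = a * (1 + b / a * cis t)" by (simp add: algebra_simps)
      then have "norm (a + b * cis t) = norm a * norm (1 + b / a * cis t)" by (metis norm_mult)
      with \<open>a \<noteq> 0\<close> nz[OF \<open>norm (b / a) < 1\<close>, of t] show ?thesis by (simp add: ln_mult)
    qed
    ultimately show ?thesis using *[of "b / a" a] True by simp
  next
    case False
    then have lt: "norm a < norm b" using assms by simp
    then have "b \<noteq> 0" by auto
    have l1: "norm (cnj (a / b)) < 1" using lt by (auto simp: norm_divide divide_simps)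
    have "ln (norm (a + b * cis t)) = ln (norm b) + ln (norm (1 + cnj (a / b) * cis t))" for t
    proof -
      have "a + b * cis t = b * cis t * cnj (1 + cnj (a / b) * cis t)"
        using \<open>b \<noteq> 0\<close> by (simp add: algebra_simps cis_cnj cis_mult)
      then have "norm (a + b * cis t) = norm b * norm (1 + cnj (a / b) * cis t)"
        by (metis norm_mult complex_mod_cnj norm_cis mult.right_neutral)
      with \<open>b \<noteq> 0\<close> nz[OF l1, of t] show ?thesis by (simp add: ln_mult)
    qed
    then show ?thesis using *[OF l1, of b] lt by simp
  qed
qed

section \<open>A cotangent integral by Fourier expansion\<close>

text \<open>Multiplying \<open>q(u) cot (u/2)\<close> by \<open>1 - cos N u\<close> removes the singular kernel: what remains is a
  sine sum, whose integral against a polynomial \<open>q\<close> is elementary.\<close>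

lemma conjugate_Dirichlet_sum:
  fixes u :: real
  assumes "sin (u / 2) \<noteq> 0"
  shows "2 * (\<Sum>n<N. sin (real n * u)) + sin (real N * u) = cot (u / 2) * (1 - cos (real N * u))"
proof (induction N)
  case (Suc N)
  define h where "h = u / 2"
  define m where "m = real N * u + h"
  have e: "real N * u = m - h" "real (Suc N) * u = m + h"
    by (simp_all add: m_def h_def algebra_simps)
  have "2 * (\<Sum>n<Suc N. sin (real n * u)) + sin (real (Suc N) * u)
      = cot h * (1 - cos (m - h)) + (sin (m - h) + sin (m + h))"
    using Suc by (simp add: e del: of_nat_Suc flip: h_def)
  also have "sin (m - h) + sin (m + h) = 2 * sin m * cos h" by (simp add: sin_add sin_diff)
  also have "2 * sin m * cos h = cot h * (cos (m - h) - cos (m + h))"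
    using assms by (simp add: cos_add cos_diff cot_def flip: h_def)
  finally have "2 * (\<Sum>n<Suc N. sin (real n * u)) + sin (real (Suc N) * u) = cot h * (1 - cos (m + h))"
    by (simp add: right_diff_distrib)
  then show ?case by (simp only: e(2) h_def)
qed simp

text \<open>The bound does not grow with \<open>N\<close>, so the averages of \<open>cos (n u)\<close> over \<open>n < N\<close> tend to zero
  pointwise on \<open>{0<..pi}\<close>.\<close>

lemma cos_sum_bound:
  fixes u :: real
  assumes "0 < u" "u \<le> pi"
  shows "\<bar>\<Sum>n<N. cos (real n * u)\<bar> \<le> 1 / sin (u / 2)"
proof -
  define h where "h = u / 2"
  have s: "sin h > 0" using assms by (auto simp: h_def intro!: sin_gt_zero)
  have "2 * sin h * (\<Sum>n<N. cos (real n * u)) = sin (real N * u - h) + sin h"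
  proof (induction N)
    case (Suc N)
    have "real (Suc N) * u - h = real N * u + h" by (simp add: h_def algebra_simps)
    moreover have "sin (real N * u + h) = sin (real N * u - h) + 2 * sin h * cos (real N * u)"
      by (simp add: sin_add sin_diff)
    ultimately show ?case using Suc by (simp add: algebra_simps)
  qed simp
  moreover have "\<bar>sin (real N * u - h) + sin h\<bar> \<le> 2"
    using abs_sin_le_one[of "real N * u - h"] abs_sin_le_one[of h] by linarith
  ultimately have "2 * sin h * \<bar>\<Sum>n<N. cos (real n * u)\<bar> \<le> 2"
    using s by (metis abs_mult abs_of_pos mult_pos_pos zero_less_numeral)
  then show ?thesis using s by (simp add: field_simps h_def)
qed

lemma cesaro_mean:
  fixes a :: "nat \<Rightarrow> real"
  assumes "a \<longlonglongrightarrow> l"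
  shows "(\<lambda>M. (\<Sum>n<M. a n) / real M) \<longlonglongrightarrow> l"
proof (rule LIMSEQ_I)
  fix e :: real assume "e > 0"
  obtain N where N: "\<And>n. n \<ge> N \<Longrightarrow> \<bar>a n - l\<bar> < e / 2"
    using LIMSEQ_D[OF assms, of "e / 2"] \<open>e > 0\<close> by auto
  define C where "C = (\<Sum>n<N. \<bar>a n - l\<bar>)"
  obtain K :: nat where K: "real K > 2 * C / e" using reals_Archimedean2 by blast
  show "\<exists>no. \<forall>M\<ge>no. norm ((\<Sum>n<M. a n) / real M - l) < e"
  proof (intro exI[of _ "max (Suc N) (Suc K)"] allI impI)
    fix M assume M: "max (Suc N) (Suc K) \<le> M"
    then have "M > 0" "N \<le> M" by auto
    have "C < e / 2 * real M"
    proof -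
      have "2 * C / e < real M" using K M by linarith
      then show ?thesis using \<open>e > 0\<close> by (simp add: field_simps)
    qed
    have "\<bar>(\<Sum>n<M. a n) - real M * l\<bar> = \<bar>\<Sum>n<M. a n - l\<bar>" by (simp add: sum_subtractf)
    also have "\<dots> \<le> (\<Sum>n<M. \<bar>a n - l\<bar>)" by (rule sum_abs)
    also have "\<dots> = C + (\<Sum>n\<in>{N..<M}. \<bar>a n - l\<bar>)"
      unfolding C_def using \<open>N \<le> M\<close> by (metis lessThan_atLeast0 sum.atLeastLessThan_concat zero_le)
    also have "(\<Sum>n\<in>{N..<M}. \<bar>a n - l\<bar>) \<le> (\<Sum>n\<in>{N..<M}. e / 2)"
      by (intro sum_mono) (use N in force)
    also have "\<dots> \<le> e / 2 * real M" using \<open>e > 0\<close> \<open>N \<le> M\<close> by simp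
    finally have "\<bar>(\<Sum>n<M. a n) - real M * l\<bar> < e * real M" using \<open>C < _\<close> by (simp add: mult.commute)
    moreover have "(\<Sum>n<M. a n) / real M - l = ((\<Sum>n<M. a n) - real M * l) / real M"
      using \<open>M > 0\<close> by (simp add: field_simps)
    ultimately show "norm ((\<Sum>n<M. a n) / real M - l) < e"
      using \<open>M > 0\<close> by (simp add: field_simps)
  qed
qed

text \<open>The weight that remains against \<open>cot (u/2)\<close> once the Mahler measure is reduced to a single
  integral; its zero at the origin cancels the pole of the cotangent.\<close>

definition quad :: "real \<Rightarrow> real" where "quad u = u * (pi / 2 - u)"

lemma quad_sin_has_integral:
  assumes "n > 0"
  shows "((\<lambda>u. quad u * sin (real n * u)) has_integral
    pi\<^sup>2 / 2 * (-1) ^ n / real n + 2 * (1 - (-1) ^ n) / real n ^ 3) {0..pi}"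
proof -
  define c where "c = real n"
  define d where "d = 1 / c"
  have cd: "c * d = 1" using assms by (simp add: c_def d_def)
  \<comment> \<open>With the reciprocal \<open>d\<close> of \<open>c\<close> the primitive found by two integrations by parts is polynomial
    in \<open>c\<close> and \<open>d\<close>, and \<open>c * d = 1\<close> is the only relation needed to check it.\<close>
  have cd2: "c * d ^ 2 = d" and cd3: "c * d ^ 3 = d ^ 2"
    using cd by (simp_all add: power2_eq_square power3_eq_cube flip: mult.assoc)
  define p where "p = pi / 2"
  define F where "F = (\<lambda>u. - (u * (p - u) * cos (c * u) * d) + (p - 2 * u) * sin (c * u) * d ^ 2
                    - 2 * cos (c * u) * d ^ 3)"
  have "(F has_real_derivative quad u * sin (c * u)) (at u within {0..pi})" for u
  proof -
    have "(F has_real_derivative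
        - ((p - 2 * u) * cos (c * u) * d) + u * (p - u) * sin (c * u) * (c * d)
        - 2 * sin (c * u) * d ^ 2 + (p - 2 * u) * cos (c * u) * (c * d ^ 2)
        + 2 * sin (c * u) * (c * d ^ 3)) (at u within {0..pi})"
      unfolding F_def
      by (rule derivative_eq_intros refl)+
         (simp add: left_diff_distrib right_diff_distrib distrib_left distrib_right mult_ac)
    then show ?thesis unfolding cd cd2 cd3 by (simp add: quad_def p_def)
  qed
  then have "((\<lambda>u. quad u * sin (c * u)) has_integral F pi - F 0) {0..pi}"
    by (intro fundamental_theorem_of_calculus) (simp_all add: has_real_derivative_iff_has_vector_derivative)
  moreover have "F pi - F 0 = - (quad pi * (-1) ^ n * d) - 2 * (-1) ^ n * d ^ 3 + 2 * d ^ 3"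
    by (simp add: F_def quad_def p_def c_def)
  moreover have "\<dots> = pi\<^sup>2 / 2 * (-1) ^ n * d + 2 * (1 - (-1) ^ n) * d ^ 3"
    by (simp add: quad_def power2_eq_square left_diff_distrib right_diff_distrib)
  ultimately show ?thesis by (simp add: c_def d_def power_one_over)
qed

text \<open>The cubic part of the sine coefficients produces \<^const>\<open>cal_L31_at_1\<close> and the linear part the
  alternating harmonic series: this is where both constants of the final formula come from.\<close>

lemma quad_coefficients_sums:
  "(\<lambda>n. pi\<^sup>2 / 2 * (-1) ^ Suc n / real (Suc n) + 2 * (1 - (-1) ^ Suc n) / real (Suc n) ^ 3) sums
    (2 * cal_L31_at_1 - pi\<^sup>2 / 2 * ln 2)"
proof -
  have s1: "summable (\<lambda>k. 1 / real (Suc k) ^ 3)"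
    using inverse_power_summable[of 3, where 'a = real] summable_Suc_iff[of "\<lambda>k. inverse (real k ^ 3)"] by (simp add: divide_inverse)
  have s2: "summable (\<lambda>k. (-1) ^ Suc k / real (Suc k) ^ 3)"
    by (rule summable_comparison_test'[OF s1, of 0]) (simp add: norm_divide power_abs)
  have "(\<lambda>k. 1 / real (Suc k) ^ 3) sums Li3 1" "(\<lambda>k. (-1) ^ Suc k / real (Suc k) ^ 3) sums Li3 (-1)"
    using summable_sums[OF s1] summable_sums[OF s2] unfolding Li3_def by simp_all
  then have "(\<lambda>k. 2 * (1 / real (Suc k) ^ 3 - (-1) ^ Suc k / real (Suc k) ^ 3)) sums (2 * cal_L31_at_1)"
    unfolding cal_L31_at_1_def by (intro sums_mult sums_diff)
  from sums_add[OF this sums_mult[OF alternating_harmonic_series_sums, of "- (pi\<^sup>2 / 2)"]]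
  show ?thesis
    by (simp add: algebra_simps diff_divide_distrib add_divide_distrib)
qed

text \<open>As \<open>cot 0 = 0\<close>, the integrand jumps at the origin; it agrees elsewhere with the continuous
  function that takes the value \<open>pi\<close> there.\<close>

lemma quad_cot_integrable:
  shows "(\<lambda>u. quad u * cot (u / 2)) integrable_on {0..pi}"
    and "(\<lambda>u. \<bar>quad u * cot (u / 2)\<bar>) integrable_on {0..pi}"
proof -
  define g where "g = (\<lambda>u. quad u * cot (u / 2))"
  define g0 where "g0 = (\<lambda>u. if u = 0 then pi else g u)"
  have lim0: "((\<lambda>u::real. sin (u / 2) / u) \<longlongrightarrow> 1 / 2) (at 0)"
  proof -
    have "((\<lambda>u::real. sin (u / 2)) has_real_derivative 1 / 2) (at 0)"
      by (auto intro!: derivative_eq_intros)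
    then show ?thesis by (simp add: DERIV_def)
  qed
  have "((\<lambda>u. (pi / 2 - u) * cos (u / 2) / (sin (u / 2) / u)) \<longlongrightarrow> (pi / 2 - 0) * cos (0 / 2) / (1 / 2)) (at 0)"
    by (intro tendsto_divide[OF _ lim0] tendsto_intros) auto
  then have g_lim: "(g \<longlongrightarrow> pi) (at 0)"
    by (simp add: g_def quad_def cot_def mult_ac)
  have cont: "continuous_on {0..pi} g0"
  proof (rule continuous_at_imp_continuous_on, rule ballI)
    fix x assume x: "x \<in> {0..pi}"
    show "isCont g0 x"
    proof (cases "x = 0")
      case True
      have "(g0 \<longlongrightarrow> pi) (at 0)"
        using g_lim by (rule Lim_transform_eventually) (auto simp: eventually_at_filter g0_def)
      then show ?thesis by (simp add: isCont_def g0_def True)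
    next
      case False
      with x have "sin (x / 2) > 0" by (intro sin_gt_zero) auto
      then have "isCont g x" unfolding g_def quad_def cot_def by (intro continuous_intros) auto
      moreover have "eventually (\<lambda>u. g0 u = g u) (nhds x)"
        by (rule eventually_mono[OF t1_space_nhds[OF False]]) (simp add: g0_def)
      ultimately show ?thesis using isCont_cong by blast
    qed
  qed
  have "g integrable_on {0..pi}"
    by (rule integrable_spike_finite[OF _ _ integrable_continuous_interval[OF cont], of "{0}"]) (auto simp: g0_def)
  then show "(\<lambda>u. quad u * cot (u / 2)) integrable_on {0..pi}" by (simp add: g_def)
  have cont_abs: "continuous_on {0..pi} (\<lambda>u. \<bar>g0 u\<bar>)" using cont by (intro continuous_intros)
  have "(\<lambda>u. \<bar>g u\<bar>) integrable_on {0..pi}"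
    by (rule integrable_spike_finite[OF _ _ integrable_continuous_interval[OF cont_abs], of "{0}"]) (auto simp: g0_def)
  then show "(\<lambda>u. \<bar>quad u * cot (u / 2)\<bar>) integrable_on {0..pi}" by (simp only: g_def)
qed

text \<open>Let \<open>g u = quad u * cot (u / 2)\<close> and \<open>a N\<close> the integral of \<open>g u * cos (N u)\<close>.  By
  \<open>conjugate_Dirichlet_sum\<close>, \<open>a N\<close> is the integral of \<open>g\<close> minus twice a partial sum of the sine
  coefficients of \<open>quad\<close> up to a null sequence, so \<open>a\<close> converges.  That its limit is zero is a case
  of the Riemann-Lebesgue lemma; since convergence is already known it is enough to look at the
  Cesaro means, which vanish in the limit by dominated convergence.\<close>

lemma quad_cot_has_integral:
  "((\<lambda>u. quad u * cot (u / 2)) has_integral 4 * cal_L31_at_1 - pi\<^sup>2 * ln 2) {0..pi}"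
proof -
  define g where "g = (\<lambda>u. quad u * cot (u / 2))"
  \<comment> \<open>\<open>D 0 = 0\<close>, by division by zero, which agrees with the vanishing of \<open>sin (0 * u)\<close>.\<close>
  define D where "D = (\<lambda>n. pi\<^sup>2 / 2 * (-1) ^ n / real n + 2 * (1 - (-1) ^ n) / real n ^ 3)"
  define S where "S = 2 * cal_L31_at_1 - pi\<^sup>2 / 2 * ln 2"
  define a where "a = (\<lambda>N. integral {0..pi} (\<lambda>u. g u * cos (real N * u)))"
  have g_int: "(g has_integral integral {0..pi} g) {0..pi}"
    and g_abs: "(\<lambda>u. \<bar>g u\<bar>) integrable_on {0..pi}"
    using quad_cot_integrable by (simp_all add: g_def has_integral_iff)
  have D_int: "((\<lambda>u. quad u * sin (real n * u)) has_integral D n) {0..pi}" for n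
    using quad_sin_has_integral[of n] by (cases "n = 0") (simp_all add: D_def)
  have a_int: "((\<lambda>u. g u * cos (real N * u)) has_integral
      integral {0..pi} g - (2 * (\<Sum>n<N. D n) + D N)) {0..pi}" for N
  proof -
    have "g u * cos (real N * u) =
        g u - (2 * (\<Sum>n<N. quad u * sin (real n * u)) + quad u * sin (real N * u))" if "u \<in> {0..pi}" for u
    proof (cases "u = 0")
      case True
      then show ?thesis by (simp add: g_def quad_def)
    next
      case False
      then have "sin (u / 2) > 0" using that by (intro sin_gt_zero) auto
      then have "quad u * (2 * (\<Sum>n<N. sin (real n * u)) + sin (real N * u)) = g u * (1 - cos (real N * u))"
        by (subst conjugate_Dirichlet_sum) (auto simp: g_def)
      then show ?thesis by (simp add: algebra_simps sum_distrib_left)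
    qed
    moreover have "((\<lambda>u. g u - (2 * (\<Sum>n<N. quad u * sin (real n * u)) + quad u * sin (real N * u)))
        has_integral integral {0..pi} g - (2 * (\<Sum>n<N. D n) + D N)) {0..pi}"
      by (intro has_integral_diff has_integral_add has_integral_mult_right has_integral_sum D_int g_int) auto
    ultimately show ?thesis by (subst has_integral_cong) auto
  qed
  have "(\<lambda>n. D (Suc n)) sums S"
    using quad_coefficients_sums by (simp add: D_def S_def del: of_nat_Suc power_Suc)
  then have D_sums: "D sums S" by (subst (asm) sums_Suc_iff) (simp add: D_def)
  from this[unfolded sums_def] have "(\<lambda>N. integral {0..pi} g - (2 * (\<Sum>n<N. D n) + D N)) \<longlonglongrightarrow> integral {0..pi} g - (2 * S + 0)"
    by (intro tendsto_intros summable_LIMSEQ_zero[OF sums_summable[OF D_sums]])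
  moreover have "a = (\<lambda>N. integral {0..pi} g - (2 * (\<Sum>n<N. D n) + D N))"
    using a_int by (auto simp: a_def integral_unique)
  ultimately have "a \<longlonglongrightarrow> integral {0..pi} g - 2 * S" by simp
  then have lim1: "(\<lambda>M. (\<Sum>N<M. a N) / real M) \<longlonglongrightarrow> integral {0..pi} g - 2 * S"
    by (rule cesaro_mean)
  have m_int: "((\<lambda>u. g u * ((\<Sum>N<M. cos (real N * u)) / real M)) has_integral (\<Sum>N<M. a N) / real M) {0..pi}" for M
  proof -
    have "((\<lambda>u. (\<Sum>N<M. g u * cos (real N * u)) * (1 / real M)) has_integral (\<Sum>N<M. a N) * (1 / real M)) {0..pi}"
      by (intro has_integral_mult_left has_integral_sum)
         (use a_int in \<open>auto simp: a_def intro!: integrable_integral\<close>)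
    then show ?thesis by (simp add: sum_distrib_left)
  qed
  have "(\<lambda>M. integral {0..pi} (\<lambda>u. g u * ((\<Sum>N<M. cos (real N * u)) / real M))) \<longlonglongrightarrow> integral {0..pi} (\<lambda>u. 0)"
  proof (rule dominated_convergence(2)[where h = "\<lambda>u. \<bar>g u\<bar>"])
    fix M u assume u: "u \<in> {0..pi}"
    have "\<bar>\<Sum>N<M. cos (real N * u)\<bar> \<le> (\<Sum>N<M. \<bar>cos (real N * u)\<bar>)" by (rule sum_abs)
    also have "\<dots> \<le> (\<Sum>N<M. 1)" by (intro sum_mono) simp
    finally have "\<bar>(\<Sum>N<M. cos (real N * u)) / real M\<bar> \<le> 1" by (cases "M = 0") (simp_all add: divide_simps)
    then show "norm (g u * ((\<Sum>N<M. cos (real N * u)) / real M)) \<le> \<bar>g u\<bar>"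
      by (simp only: real_norm_def abs_mult mult_left_le abs_ge_zero)
  next
    fix u assume u: "u \<in> {0..pi}"
    show "(\<lambda>M. g u * ((\<Sum>N<M. cos (real N * u)) / real M)) \<longlonglongrightarrow> 0"
    proof (cases "u = 0")
      case True
      then show ?thesis by (simp add: g_def quad_def)
    next
      case False
      have "(\<lambda>M. 1 / sin (u / 2) / real M) \<longlonglongrightarrow> 0" by (intro lim_const_over_n)
      moreover have "norm ((\<Sum>N<M. cos (real N * u)) / real M) \<le> 1 / sin (u / 2) / real M" for M
      proof -
        have "\<bar>\<Sum>N<M. cos (real N * u)\<bar> / real M \<le> 1 / sin (u / 2) / real M"
          using u False by (intro divide_right_mono cos_sum_bound) auto
        then show ?thesis by simp
      qed
      ultimately have "(\<lambda>M. (\<Sum>N<M. cos (real N * u)) / real M) \<longlonglongrightarrow> 0"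
        by (rule Lim_null_comparison[OF always_eventually[OF allI], rotated])
      then show ?thesis by (rule tendsto_mult_right_zero)
    qed
  qed (use m_int g_abs in \<open>auto simp: has_integral_iff\<close>)
  then have "(\<lambda>M. (\<Sum>N<M. a N) / real M) \<longlonglongrightarrow> 0"
    unfolding integral_unique[OF m_int] by simp
  with lim1 have "integral {0..pi} g - 2 * S = 0" using LIMSEQ_unique by blast
  then have "integral {0..pi} g = 4 * cal_L31_at_1 - pi\<^sup>2 * ln 2" by (simp add: S_def)
  with g_int show ?thesis by (simp add: g_def)
qed

section \<open>The double integral of a logarithm\<close>

lemma has_integral_translate:
  fixes f :: "real \<Rightarrow> real"
  assumes "(f has_integral I) {a..b}"
  shows "((\<lambda>x. f (x + c)) has_integral I) {a - c..b - c}"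
proof -
  have "(\<lambda>x. x + - c) ` {a..b} = {a - c..b - c}"
    by (simp add: image_add_atLeastAtMost')
  then show ?thesis
    using has_integral_affinity[of f I a b 1 c] assms by simp
qed

lemma has_integral_reflect_at:
  fixes f :: "real \<Rightarrow> real"
  assumes "(f has_integral I) {a..b}"
  shows "((\<lambda>x. f (c - x)) has_integral I) {c - b..c - a}"
  using has_integral_translate[OF iffD2[OF has_integral_reflect_real assms], of "- c"]
  by (simp add: minus_add algebra_simps)

abbreviation half_turn :: "real set" where "half_turn \<equiv> {-(pi / 2)..pi / 2}"

lemma one_plus_cos_cos_pos:
  assumes "b \<in> half_turn" "v \<in> half_turn"
  shows "1 + cos b * cos v > 0"
proof -
  have "cos b \<ge> 0" "cos v \<ge> 0" using assms by (auto intro!: cos_ge_zero)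
  then show ?thesis by (simp add: add_pos_nonneg)
qed

text \<open>Up to sign the integrand is the derivative of \<open>ln (1 + cos b * cos v)\<close> in \<open>b\<close>.  The half-angle
  substitution gives the primitive of \<open>1 / (1 + cos b * cos v)\<close> in \<open>v\<close> as
  \<open>2 / sin b * arctan (tan (b / 2) * tan (v / 2))\<close>; multiplied by \<open>sin b\<close> it makes sense at \<open>b = 0\<close>
  too.  At \<open>v = pi / 2\<close> the arctangent is just \<open>b / 2\<close>.\<close>

lemma log_derivative_has_integral:
  assumes "\<bar>b\<bar> < pi / 2"
  shows "((\<lambda>v. sin b * cos v / (1 + cos b * cos v)) has_integral (pi * sin b - 2 * b) / cos b) half_turn"
proof -
  define T where "T = tan (b / 2)"
  define F where "F = (\<lambda>v. (sin b * v - 2 * arctan (T * tan (v / 2))) / cos b)"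
  have cb: "cos b > 0" using assms by (intro cos_gt_zero_pi) auto
  have cb2: "cos (b / 2) > 0" using assms by (intro cos_gt_zero_pi) auto
  have F: "(F has_real_derivative sin b * cos v / (1 + cos b * cos v)) (at v within half_turn)" if v: "v \<in> half_turn" for v
  proof -
    have cv2: "cos (v / 2) > 0" using v pi_gt_zero unfolding atLeastAtMost_iff by (intro cos_gt_zero_pi) linarith+
    have pos: "1 + cos b * cos v > 0" by (rule one_plus_cos_cos_pos[OF _ v]) (use assms in auto)
    have half: "1 + cos b * cos v = 2 * ((cos (b / 2))\<^sup>2 * (cos (v / 2))\<^sup>2 + (sin (b / 2))\<^sup>2 * (sin (v / 2))\<^sup>2)"
    proof -
      have double: "cos b = 2 * (cos (b / 2))\<^sup>2 - 1" "cos v = 2 * (cos (v / 2))\<^sup>2 - 1"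
        using cos_double_cos[of "b / 2"] cos_double_cos[of "v / 2"] by simp_all
      show ?thesis unfolding double sin_squared_eq by (simp add: algebra_simps)
    qed
    have "((\<lambda>v. arctan (T * tan (v / 2))) has_real_derivative
        inverse (1 + (T * tan (v / 2))\<^sup>2) * (T * (inverse ((cos (v / 2))\<^sup>2) * (1 / 2)))) (at v within half_turn)"
      using cv2 by (auto intro!: derivative_eq_intros)
    also have "inverse (1 + (T * tan (v / 2))\<^sup>2) * (T * (inverse ((cos (v / 2))\<^sup>2) * (1 / 2))) =
        sin (b / 2) * cos (b / 2) / (2 * ((cos (b / 2))\<^sup>2 * (cos (v / 2))\<^sup>2 + (sin (b / 2))\<^sup>2 * (sin (v / 2))\<^sup>2))"
    proof -
      define Q where "Q = (cos (b / 2))\<^sup>2 * (cos (v / 2))\<^sup>2 + (sin (b / 2))\<^sup>2 * (sin (v / 2))\<^sup>2"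
      have "Q > 0" using half pos by (simp add: Q_def)
      have "1 + (T * tan (v / 2))\<^sup>2 = Q / ((cos (b / 2))\<^sup>2 * (cos (v / 2))\<^sup>2)"
        using cb2 cv2 by (simp add: T_def tan_def Q_def power_divide power_mult_distrib add_divide_distrib)
      then show ?thesis using \<open>Q > 0\<close> cb2 cv2
        unfolding Q_def[symmetric] by (simp add: T_def tan_def field_simps power2_eq_square)
    qed
    also have "\<dots> = sin b / 2 / (1 + cos b * cos v)"
      using sin_double[of "b / 2"] by (simp add: half)
    finally have "(F has_real_derivative (sin b * 1 - 2 * (sin b / 2 / (1 + cos b * cos v))) / cos b) (at v within half_turn)"
      unfolding F_def by (intro DERIV_cdivide DERIV_diff DERIV_cmult DERIV_ident)
    also have "(sin b * 1 - 2 * (sin b / 2 / (1 + cos b * cos v))) / cos b = sin b * cos v / (1 + cos b * cos v)"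
    proof -
      define E where "E = 1 + cos b * cos v"
      have "E \<noteq> 0" using pos by (simp add: E_def)
      then have "sin b * 1 - 2 * (sin b / 2 / E) = sin b * (E - 1) / E" by (simp add: field_simps)
      also have "\<dots> / cos b = sin b * cos v / E" using cb by (simp add: E_def)
      finally show ?thesis by (simp only: E_def)
    qed
    finally show ?thesis .
  qed
  have "((\<lambda>v. sin b * cos v / (1 + cos b * cos v)) has_integral F (pi / 2) - F (- (pi / 2))) half_turn"
    by (intro fundamental_theorem_of_calculus) (use F pi_ge_zero in \<open>simp_all add: has_real_derivative_iff_has_vector_derivative\<close>)
  moreover have "arctan T = b / 2" unfolding T_def using assms by (intro arctan_tan) auto
  then have "F (pi / 2) - F (- (pi / 2)) = (pi * sin b - 2 * b) / cos b"
    by (simp add: F_def tan_45 tan_minus arctan_minus diff_divide_distrib)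
  ultimately show ?thesis by simp
qed

text \<open>The boundary terms vanish because \<open>cos b = 0\<close> at both ends.\<close>

lemma integral_ln_by_parts:
  assumes v: "v \<in> half_turn"
  shows "integral half_turn (\<lambda>b. ln (1 + cos b * cos v)) =
         integral half_turn (\<lambda>b. b * (sin b * cos v / (1 + cos b * cos v)))"
proof -
  have pos: "1 + cos b * cos v > 0" if "b \<in> half_turn" for b
    using one_plus_cos_cos_pos[OF that v] .
  define F where "F = (\<lambda>b. b * ln (1 + cos b * cos v))"
  have "(F has_real_derivative ln (1 + cos b * cos v) - b * (sin b * cos v / (1 + cos b * cos v))) (at b within half_turn)"
    if "b \<in> half_turn" for b
    unfolding F_def using pos[OF that] by (auto intro!: derivative_eq_intros)
  then have "((\<lambda>b. ln (1 + cos b * cos v) - b * (sin b * cos v / (1 + cos b * cos v)))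
      has_integral F (pi / 2) - F (- (pi / 2))) half_turn"
    by (intro fundamental_theorem_of_calculus) (use pi_ge_zero in \<open>simp_all add: has_real_derivative_iff_has_vector_derivative\<close>)
  moreover have "F (pi / 2) - F (- (pi / 2)) = 0" by (simp add: F_def)
  ultimately have "integral half_turn (\<lambda>b. ln (1 + cos b * cos v) - b * (sin b * cos v / (1 + cos b * cos v))) = 0"
    by (simp add: integral_unique)
  moreover have "(\<lambda>b. ln (1 + cos b * cos v)) integrable_on half_turn"
    "(\<lambda>b. b * (sin b * cos v / (1 + cos b * cos v))) integrable_on half_turn"
    by (intro integrable_continuous_interval continuous_intros; use pos in force)+
  ultimately show ?thesis by (simp add: Henstock_Kurzweil_Integration.integral_diff)
qed

text \<open>With \<open>u = b + pi / 2\<close> the quotient becomes \<open>(pi - u) * tan (u / 2) - u * cot (u / 2)\<close>, and the two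
  terms, weighted by \<open>b\<close>, are \<open>quad * cot\<close> evaluated at \<open>pi - u\<close> and at \<open>u\<close>.\<close>

lemma reduced_density_has_integral:
  "((\<lambda>b. b * ((pi * sin b - 2 * b) / cos b)) has_integral 8 * cal_L31_at_1 - 2 * pi\<^sup>2 * ln 2) half_turn"
proof -
  define g where "g = (\<lambda>u. quad u * cot (u / 2))"
  define G where "G = 4 * cal_L31_at_1 - pi\<^sup>2 * ln 2"
  have g: "(g has_integral G) {0..pi}" using quad_cot_has_integral by (simp add: g_def G_def)
  have "((\<lambda>u. g (pi - u)) has_integral G) {0..pi}" using has_integral_reflect_at[OF g, of pi] by simp
  from has_integral_translate[OF has_integral_add[OF g this], of "pi / 2"]
  have sum_int: "((\<lambda>b. g (b + pi / 2) + g (pi - (b + pi / 2))) has_integral 2 * G) half_turn" by simp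
  have density: "g (b + pi / 2) + g (pi - (b + pi / 2)) = b * ((pi * sin b - 2 * b) / cos b)"
    if "b \<in> half_turn - {pi / 2, - (pi / 2)}" for b
  proof -
    \<comment> \<open>half of the shifted variable \<open>u = b + pi / 2\<close>\<close>
    define h where "h = b / 2 + pi / 4"
    have "0 < h" "h < pi / 2" using that by (auto simp: h_def)
    then have sh: "sin h > 0" and ch: "cos h > 0" by (auto intro!: sin_gt_zero cos_gt_zero)
    have b: "b = 2 * h - pi / 2" by (simp add: h_def)
    have "sin b = 1 - 2 * (cos h)\<^sup>2" "cos b = 2 * sin h * cos h"
      by (simp_all add: b sin_diff cos_diff cos_double_cos sin_double)
    moreover have "g (b + pi / 2) = (b + pi / 2) * (- b) * (cos h / sin h)"
      by (simp add: g_def quad_def cot_def h_def add_divide_distrib)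
    moreover have "g (pi - (b + pi / 2)) = (pi / 2 - b) * b * (sin h / cos h)"
    proof -
      have "(pi - (b + pi / 2)) / 2 = pi / 2 - h" by (simp add: h_def field_simps)
      then have "g (pi - (b + pi / 2)) = quad (pi - (b + pi / 2)) * cot (pi / 2 - h)" by (simp only: g_def)
      then show ?thesis by (simp add: quad_def cot_def sin_diff cos_diff)
    qed
    moreover have "(sin h)\<^sup>2 = 1 - (cos h)\<^sup>2" by (rule sin_squared_eq)
    ultimately show ?thesis using sh ch by (simp add: divide_simps) algebra
  qed
  have "((\<lambda>b. b * ((pi * sin b - 2 * b) / cos b)) has_integral 2 * G) half_turn"
    by (rule has_integral_spike_finite[OF _ _ sum_int, of "{pi / 2, - (pi / 2)}"]) (simp_all only: density finite.intros)
  then show ?thesis by (simp add: G_def algebra_simps)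
qed

definition ln_cos_integral :: "real \<Rightarrow> real" where
  "ln_cos_integral s = integral half_turn (\<lambda>v. ln (1 + s * cos v))"

lemma ln_cos_integral_has_integral:
  assumes "0 \<le> s"
  shows "((\<lambda>v. ln (1 + s * cos v)) has_integral ln_cos_integral s) half_turn"
proof -
  have "1 + s * cos v > 0" if "v \<in> half_turn" for v
    using that assms by (intro add_pos_nonneg mult_nonneg_nonneg) (auto intro!: cos_ge_zero)
  then have "continuous_on half_turn (\<lambda>v. ln (1 + s * cos v))"
    by (intro continuous_intros) force
  then show ?thesis unfolding ln_cos_integral_def
    by (intro integrable_integral integrable_continuous_interval)
qed

text \<open>The double integral of \<open>ln (1 + cos b * cos v)\<close>: integrating by parts in \<open>b\<close> replaces the
  logarithm by a rational function of \<open>cos v\<close>, whose integral over \<open>v\<close> is elementary.  Exchanging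
  the order of integration before and after leaves a single integral in \<open>b\<close>.\<close>

lemma ln_cos_integral_cos_has_integral:
  "((\<lambda>b. ln_cos_integral (cos b)) has_integral 8 * cal_L31_at_1 - 2 * pi\<^sup>2 * ln 2) half_turn"
proof -
  have cont1: "continuous_on (half_turn \<times> half_turn) (\<lambda>(b, v). ln (1 + cos b * cos v))"
    unfolding split_def using one_plus_cos_cos_pos by (intro continuous_intros) force
  have cont2: "continuous_on (half_turn \<times> half_turn) (\<lambda>(b, v). b * (sin b * cos v / (1 + cos b * cos v)))"
    unfolding split_def using one_plus_cos_cos_pos by (intro continuous_intros) force
  note [simp] = cbox_Pair_eq
  have "continuous_on half_turn (\<lambda>b. integral half_turn (\<lambda>v. ln (1 + cos b * cos v)))"
    using integral_continuous_on_param[of half_turn "- (pi / 2)" "pi / 2" "\<lambda>b v. ln (1 + cos b * cos v)"] cont1 by simp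
  then have int: "(\<lambda>b. ln_cos_integral (cos b)) integrable_on half_turn"
    unfolding ln_cos_integral_def by (rule integrable_continuous_interval)
  have "integral half_turn (\<lambda>b. ln_cos_integral (cos b)) =
      integral half_turn (\<lambda>v. integral half_turn (\<lambda>b. ln (1 + cos b * cos v)))"
    using integral_swap_continuous[of "- (pi / 2)" "- (pi / 2)" "pi / 2" "pi / 2" "\<lambda>b v. ln (1 + cos b * cos v)"] cont1
    by (simp add: ln_cos_integral_def)
  also have "\<dots> = integral half_turn (\<lambda>v. integral half_turn (\<lambda>b. b * (sin b * cos v / (1 + cos b * cos v))))"
    by (intro integral_cong integral_ln_by_parts)
  also have "\<dots> = integral half_turn (\<lambda>b. integral half_turn (\<lambda>v. b * (sin b * cos v / (1 + cos b * cos v))))"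
    using integral_swap_continuous[of "- (pi / 2)" "- (pi / 2)" "pi / 2" "pi / 2" "\<lambda>b v. b * (sin b * cos v / (1 + cos b * cos v))"] cont2
    by simp
  also have "\<dots> = 8 * cal_L31_at_1 - 2 * pi\<^sup>2 * ln 2"
  proof (rule integral_unique, rule has_integral_spike_finite[OF _ _ reduced_density_has_integral])
    show "finite {pi / 2, - (pi / 2)}" by simp
    fix b assume "b \<in> half_turn - {pi / 2, - (pi / 2)}"
    then have "\<bar>b\<bar> < pi / 2" by auto
    from integral_unique[OF has_integral_mult_right[OF log_derivative_has_integral[OF this], of b]]
    show "integral half_turn (\<lambda>v. b * (sin b * cos v / (1 + cos b * cos v))) = b * ((pi * sin b - 2 * b) / cos b)" .
  qed
  finally show ?thesis using int by (metis has_integral_iff)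
qed

section \<open>From the circle to half turns\<close>

text \<open>On the circle the sine runs through the values of the cosine on \<^term>\<open>half_turn\<close> twice, once with
  each sign.\<close>

lemma has_integral_sin_half_turns:
  fixes f :: "real \<Rightarrow> real"
  assumes "((\<lambda>x. f (cos x)) has_integral I) half_turn"
  shows "((\<lambda>x. f (sin x)) has_integral I) {0..pi}"
    and "((\<lambda>x. f (- sin x)) has_integral I) {pi..2 * pi}"
proof -
  show "((\<lambda>x. f (sin x)) has_integral I) {0..pi}"
    using has_integral_translate[OF assms, of "- (pi / 2)"] by (simp add: cos_diff)
  have "cos (x + - (3 * pi / 2)) = - sin x" for x
  proof -
    have "x + - (3 * pi / 2) = (x - pi / 2) - pi" by simp
    then show ?thesis by (simp only: cos_diff sin_diff) simp
  qed
  then show "((\<lambda>x. f (- sin x)) has_integral I) {pi..2 * pi}"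
    using has_integral_translate[OF assms, of "- (3 * pi / 2)"] by simp
qed

lemma sin_nonneg_first_half: "x \<in> {0..pi} \<Longrightarrow> 0 \<le> sin x"
  by (auto intro: sin_ge_zero)

lemma sin_nonpos_second_half: "x \<in> {pi..2 * pi} \<Longrightarrow> sin x \<le> 0"
  using sin_le_zero[of x] by (cases "x = 2 * pi") auto

text \<open>Only the half of the circle on which \<open>s * sin x\<close> is positive contributes.\<close>

lemma ln_positive_part_has_integral:
  "((\<lambda>x. ln (1 + max 0 (s * sin x))) has_integral ln_cos_integral \<bar>s\<bar>) {0..2 * pi}"
proof -
  have A: "((\<lambda>x. ln (1 + \<bar>s\<bar> * sin x)) has_integral ln_cos_integral \<bar>s\<bar>) {0..pi}"
    and B: "((\<lambda>x. ln (1 + \<bar>s\<bar> * - sin x)) has_integral ln_cos_integral \<bar>s\<bar>) {pi..2 * pi}"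
    by (rule has_integral_sin_half_turns[of "\<lambda>z. ln (1 + \<bar>s\<bar> * z)"]; rule ln_cos_integral_has_integral; simp)+
  show ?thesis
  proof (cases "s \<ge> 0")
    case True
    have "((\<lambda>x. ln (1 + max 0 (s * sin x))) has_integral ln_cos_integral \<bar>s\<bar>) {0..pi}"
      using A by (rule has_integral_eq[rotated]) (use True sin_nonneg_first_half in \<open>auto simp: max_absorb2\<close>)
    moreover have "((\<lambda>x. ln (1 + max 0 (s * sin x))) has_integral 0) {pi..2 * pi}"
      by (rule has_integral_is_0) (use True sin_nonpos_second_half in \<open>auto simp: max_absorb1 mult_nonneg_nonpos\<close>)
    ultimately show ?thesis
      using has_integral_combine[of 0 pi "2 * pi"] by fastforce
  next
    case False
    have "((\<lambda>x. ln (1 + max 0 (s * sin x))) has_integral ln_cos_integral \<bar>s\<bar>) {pi..2 * pi}"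
      using B by (rule has_integral_eq[rotated]) (use False sin_nonpos_second_half in \<open>auto simp: max_absorb2 mult_nonpos_nonpos\<close>)
    moreover have "((\<lambda>x. ln (1 + max 0 (s * sin x))) has_integral 0) {0..pi}"
      by (rule has_integral_is_0) (use False sin_nonneg_first_half in \<open>auto simp: max_absorb1 mult_nonpos_nonneg\<close>)
    ultimately show ?thesis
      using has_integral_combine[of 0 pi "2 * pi"] by fastforce
  qed
qed

lemma ln_cos_integral_abs_sin_has_integral:
  "((\<lambda>u. ln_cos_integral \<bar>sin u\<bar>) has_integral 2 * (8 * cal_L31_at_1 - 2 * pi\<^sup>2 * ln 2)) {0..2 * pi}"
proof -
  let ?K = "8 * cal_L31_at_1 - 2 * pi\<^sup>2 * ln 2"
  note * = has_integral_sin_half_turns[OF ln_cos_integral_cos_has_integral]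
  have "((\<lambda>u. ln_cos_integral \<bar>sin u\<bar>) has_integral ?K) {0..pi}"
    using *(1) by (rule has_integral_eq[rotated]) (use sin_nonneg_first_half in auto)
  moreover have "((\<lambda>u. ln_cos_integral \<bar>sin u\<bar>) has_integral ?K) {pi..2 * pi}"
    using *(2) by (rule has_integral_eq[rotated]) (use sin_nonpos_second_half in auto)
  ultimately have "((\<lambda>u. ln_cos_integral \<bar>sin u\<bar>) has_integral ?K + ?K) {0..2 * pi}"
    by (rule has_integral_combine[rotated 2]) auto
  then show ?thesis by (simp only: mult_2)
qed

text \<open>Used to see that the partially integrated functions are nonnegative, as integration in
  \<^typ>\<open>ennreal\<close> requires.\<close>

lemma ln_cos_integral_le:
  assumes "0 \<le> s" "s \<le> 1"
  shows "ln_cos_integral s \<le> pi * ln 2"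
proof -
  have "ln (1 + s * cos v) \<le> ln 2" if "v \<in> half_turn" for v
  proof -
    have "0 \<le> cos v" using that by (auto intro!: cos_ge_zero)
    moreover have "s * cos v \<le> 1" using assms \<open>0 \<le> cos v\<close> by (simp add: mult_le_one)
    ultimately show ?thesis using assms by (simp add: add_pos_nonneg)
  qed
  with has_integral_le[OF ln_cos_integral_has_integral[OF assms(1)] has_integral_const_real[of "ln 2"]]
  show ?thesis by simp
qed

section \<open>Evaluation of polynomials\<close>

lemma eval_cpoly_superset:
  assumes "finite S" "Poly_Mapping.keys P \<subseteq> S"
  shows "eval_cpoly P x = (\<Sum>m\<in>S. Poly_Mapping.lookup P m * (\<Prod>i\<in>UNIV. x i ^ Poly_Mapping.lookup m i))"
  unfolding eval_cpoly_def using assms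
  by (intro sum.mono_neutral_left) (auto simp: in_keys_iff)

lemma eval_cpoly_add: "eval_cpoly (P + Q) x = eval_cpoly P x + eval_cpoly Q x"
proof -
  let ?S = "Poly_Mapping.keys P \<union> Poly_Mapping.keys Q"
  have "Poly_Mapping.keys (P + Q) \<subseteq> ?S" by (rule Poly_Mapping.keys_add)
  then show ?thesis
    by (simp add: eval_cpoly_superset[of ?S] lookup_add distrib_right sum.distrib)
qed

lemma eval_cpoly_uminus: "eval_cpoly (- P) x = - eval_cpoly P x"
  by (simp add: eval_cpoly_def sum_negf)

lemma eval_cpoly_single:
  "eval_cpoly (Poly_Mapping.single m c) x = c * (\<Prod>i\<in>UNIV. x i ^ Poly_Mapping.lookup m i)"
  by (simp add: eval_cpoly_superset[of "{m}"])

lemma eval_cpoly_one: "eval_cpoly 1 x = 1"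
  using eval_cpoly_single[of 0 1 x] by simp

lemma eval_cpoly_var: "eval_cpoly (var i) x = x i"
proof -
  have "(\<Prod>j\<in>UNIV. x j ^ Poly_Mapping.lookup (Poly_Mapping.single i 1) j) = (\<Prod>j\<in>UNIV. if j = i then x j else 1)"
    by (intro prod.cong) (auto simp: lookup_single when_def)
  then show ?thesis by (simp add: var_def eval_cpoly_single)
qed

text \<open>Products of two variables are the only products that occur in the expanded polynomial.\<close>

lemma eval_cpoly_var_mult_var: "eval_cpoly (var i * var j) x = x i * x j"
proof -
  have "eval_cpoly (var i * var j) x = eval_cpoly (var i) x * eval_cpoly (var j) x"
    by (simp add: var_def mult_single eval_cpoly_single lookup_add power_add prod.distrib)
  then show ?thesis by (simp add: eval_cpoly_var)
qed

text \<open>The terms \<open>y\<close> and \<open>- y\<close> cancel, so the polynomial is linear in \<open>y\<close> with coefficient \<open>2 w\<close>, of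
  constant modulus 2 on the torus.\<close>

lemma eval_linear_in_y:
  fixes x :: "3 \<Rightarrow> complex"
  shows "eval_cpoly ((1 + var 1) * (1 + var 3) + (1 - var 1) * (var 2 - var 3)) x =
    (1 + x 1 + (1 - x 1) * x 2) + 2 * x 1 * x 3"
proof -
  have "((1 + var 1) * (1 + var 3) + (1 - var 1) * (var 2 - var 3) :: 3 cpoly) =
      1 + var 1 + var 2 + - (var 1 * var 2) + (var 1 * var 3 + var 1 * var 3)"
    by (simp add: algebra_simps)
  then show ?thesis
    by (simp only: eval_cpoly_add eval_cpoly_uminus eval_cpoly_one eval_cpoly_var eval_cpoly_var_mult_var)
       (simp add: algebra_simps)
qed

section \<open>Iterated integrals over the torus\<close>

abbreviation circle_angle :: "real measure" where
  "circle_angle \<equiv> restrict_space lborel {0..2 * pi}"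

lemma nn_integral_circle_angle:
  assumes "(f has_integral I) {0..2 * pi}" "\<And>x. x \<in> {0..2 * pi} \<Longrightarrow> 0 \<le> f x"
  shows "(\<integral>\<^sup>+ x. ennreal (f x) \<partial>circle_angle) = ennreal I"
  using nn_integral_has_integral_lebesgue'[OF assms(2,1)]
  by (simp add: nn_integral_restrict_space)

lemma emeasure_circle_angle: "emeasure circle_angle {0..2 * pi} = ennreal (2 * pi)"
  by (simp add: emeasure_restrict_space)

lemma sigma_finite_circle_angle: "sigma_finite_measure circle_angle"
proof -
  have "finite_measure circle_angle"
    by (rule finite_measureI) (simp add: space_restrict_space emeasure_restrict_space)
  then show ?thesis by (simp add: finite_measure_def)
qed

lemma AE_circle_angle_sin_nonzero: "AE x in circle_angle. sin x \<noteq> 0"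
proof -
  have "AE x in lborel. x \<noteq> c" for c :: real by (rule AE_lborel_singleton)
  from this[of 0] this[of pi] this[of "2 * pi"]
  have "AE x in lborel. x \<in> {0..2 * pi} \<longrightarrow> sin x \<noteq> 0"
  proof eventually_elim
    case (elim x)
    then have "sin x > 0 \<or> sin x < 0" if "x \<in> {0..2 * pi}"
      using that sin_gt_zero[of x] sin_lt_zero[of x] by (cases "x < pi") auto
    then show ?case by auto
  qed
  then show ?thesis by (simp add: AE_restrict_space_iff)
qed

lemma measurable_compose_3:
  assumes "(\<lambda>(a, b, c). F a b c) \<in> N \<Otimes>\<^sub>M N \<Otimes>\<^sub>M N \<rightarrow>\<^sub>M K"
    and "f \<in> M \<rightarrow>\<^sub>M N" "g \<in> M \<rightarrow>\<^sub>M N" "h \<in> M \<rightarrow>\<^sub>M N"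
  shows "(\<lambda>x. F (f x) (g x) (h x)) \<in> M \<rightarrow>\<^sub>M K"
  using measurable_compose[OF measurable_Pair[OF assms(2) measurable_Pair[OF assms(3,4)]] assms(1)] by simp

lemma nn_integral_PiM_3:
  fixes F :: "'a \<Rightarrow> 'a \<Rightarrow> 'a \<Rightarrow> ennreal"
  assumes "sigma_finite_measure N"
    and F: "(\<lambda>(a, b, c). F a b c) \<in> borel_measurable (N \<Otimes>\<^sub>M N \<Otimes>\<^sub>M N)"
  shows "(\<integral>\<^sup>+ t. F (t 1) (t 2) (t 3) \<partial>(\<Pi>\<^sub>M j\<in>(UNIV :: 3 set). N)) =
    (\<integral>\<^sup>+ a. \<integral>\<^sup>+ b. \<integral>\<^sup>+ c. F a b c \<partial>N \<partial>N \<partial>N)"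
proof -
  interpret sigma_finite_measure N by fact
  interpret product_sigma_finite "\<lambda>_ :: 3. N" by standard
  have U: "(UNIV :: 3 set) = insert 3 {1, 2}" "{1, 2 :: 3} = insert 2 {1}" unfolding UNIV_3 by auto
  note [measurable] = measurable_compose_3[OF F]
  have "(\<integral>\<^sup>+ t. F (t 1) (t 2) (t 3) \<partial>(\<Pi>\<^sub>M j\<in>(UNIV :: 3 set). N)) =
      (\<integral>\<^sup>+ t. \<integral>\<^sup>+ c. F (t 1) (t 2) c \<partial>N \<partial>(\<Pi>\<^sub>M j\<in>{1, 2 :: 3}. N))"
    unfolding U(1) by (subst product_nn_integral_insert) (auto intro!: measurable_compose_3[OF F] measurable_component_singleton)
  also have "\<dots> = (\<integral>\<^sup>+ t. \<integral>\<^sup>+ b. \<integral>\<^sup>+ c. F (t 1) b c \<partial>N \<partial>N \<partial>(\<Pi>\<^sub>M j\<in>{1 :: 3}. N))"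
    unfolding U(2) by (subst product_nn_integral_insert) auto
  also have "\<dots> = (\<integral>\<^sup>+ a. \<integral>\<^sup>+ b. \<integral>\<^sup>+ c. F a b c \<partial>N \<partial>N \<partial>N)"
    by (rule product_nn_integral_singleton) measurable
  finally show ?thesis .
qed

text \<open>Integrating \<open>ln B - ln |p| \<ge> 0\<close> instead of \<open>ln |p|\<close> allows Tonelli's theorem to be used, and
  the finite value \<open>V\<close> then yields the integrability of \<open>ln |p|\<close>, in spite of its singularities at the
  zeros of \<open>p\<close>.  The bound \<open>1 \<le> B\<close> also covers these zeros, where \<open>ln 0 = 0\<close>.\<close>

lemma mahler_measure_3_eq:
  fixes P :: "3 cpoly" and p :: "real \<Rightarrow> real \<Rightarrow> real \<Rightarrow> complex"
  assumes eval: "\<And>t. eval_cpoly P (\<lambda>j. cis (t j)) = p (t 1) (t 2) (t 3)"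
    and meas: "(\<lambda>(a, b, c). p a b c) \<in> borel_measurable (borel \<Otimes>\<^sub>M borel \<Otimes>\<^sub>M borel)"
    and bound: "\<And>a b c. norm (p a b c) \<le> B" "1 \<le> B"
    and "(\<integral>\<^sup>+ a. \<integral>\<^sup>+ b. \<integral>\<^sup>+ c. ennreal (ln B - ln (norm (p a b c))) \<partial>circle_angle \<partial>circle_angle \<partial>circle_angle) = ennreal V"
    and "0 \<le> V"
  shows "mahler_measure P = ln B - V / (2 * pi) ^ 3"
proof -
  let ?M = "\<Pi>\<^sub>M j\<in>(UNIV :: 3 set). circle_angle"
  interpret C: sigma_finite_measure circle_angle by (rule sigma_finite_circle_angle)
  interpret product_sigma_finite "\<lambda>_ :: 3. circle_angle" by standard
  have id [measurable]: "(\<lambda>x. x) \<in> circle_angle \<rightarrow>\<^sub>M borel"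
    by (rule measurable_restrict_space1) simp
  have p [measurable]: "(\<lambda>(a, b, c). p a b c) \<in> borel_measurable (circle_angle \<Otimes>\<^sub>M circle_angle \<Otimes>\<^sub>M circle_angle)"
  proof -
    have "(\<lambda>(a, b, c). (a, b, c)) \<in> circle_angle \<Otimes>\<^sub>M circle_angle \<Otimes>\<^sub>M circle_angle \<rightarrow>\<^sub>M borel \<Otimes>\<^sub>M borel \<Otimes>\<^sub>M (borel :: real measure)"
      by measurable
    from measurable_compose[OF this meas] show ?thesis by (simp add: split_beta')
  qed
  define f where "f = (\<lambda>t :: 3 \<Rightarrow> real. ln (norm (p (t 1) (t 2) (t 3))))"
  have p_meas: "(\<lambda>t. p (t 1) (t 2) (t 3)) \<in> borel_measurable ?M"
    by (intro measurable_compose_3[OF p] measurable_component_singleton) auto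
  then have f_meas: "f \<in> borel_measurable ?M" unfolding f_def by measurable
  have nonneg: "0 \<le> ln B - ln (norm (p a b c))" for a b c
    using bound(1)[of a b c] bound(2) by (cases "p a b c = 0") auto
  have "(\<integral>\<^sup>+ t. ennreal (ln B - f t) \<partial>?M) = ennreal V"
    unfolding f_def
  proof (subst nn_integral_PiM_3[where F = "\<lambda>a b c. ennreal (ln B - ln (norm (p a b c)))"])
    show "(\<lambda>(a, b, c). ennreal (ln B - ln (norm (p a b c)))) \<in>
        borel_measurable (circle_angle \<Otimes>\<^sub>M circle_angle \<Otimes>\<^sub>M circle_angle)"
      using measurable_compose[OF p, of "\<lambda>z. ennreal (ln B - ln (norm z))" borel] by (simp add: split_beta')
  qed (fact sigma_finite_circle_angle, fact assms(5))
  then have int1: "has_bochner_integral ?M (\<lambda>t. ln B - f t) V"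
    using f_meas nonneg \<open>0 \<le> V\<close> by (intro has_bochner_integral_nn_integral) (auto simp: f_def)
  have "{0..2 * pi} \<in> sets circle_angle"
    using sets.top[of circle_angle] by (simp add: space_restrict_space)
  then have "emeasure ?M (space ?M) = (\<Prod>j\<in>(UNIV :: 3 set). emeasure circle_angle {0..2 * pi})"
    unfolding space_PiM by (subst emeasure_PiM) (auto simp: space_restrict_space)
  also have "\<dots> = ennreal ((2 * pi) ^ 3)"
    by (simp add: emeasure_circle_angle ennreal_power)
  finally have space: "emeasure ?M (space ?M) = ennreal ((2 * pi) ^ 3)" .
  then have int2: "has_bochner_integral ?M (\<lambda>t. ln B) ((2 * pi) ^ 3 * ln B)"
  proof -
    have "(\<integral>\<^sup>+ t. ennreal (ln B) \<partial>?M) = ennreal ((2 * pi) ^ 3 * ln B)"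
    proof -
      have "(\<integral>\<^sup>+ t. ennreal (ln B) \<partial>?M) = ennreal (ln B) * ennreal ((2 * pi) ^ 3)"
        by (simp only: nn_integral_const space)
      also have "\<dots> = ennreal (ln B * (2 * pi) ^ 3)"
        using bound(2) by (subst ennreal_mult) auto
      finally show ?thesis by (simp only: mult.commute)
    qed
    then show ?thesis
      using bound(2) by (intro has_bochner_integral_nn_integral) auto
  qed
  have "has_bochner_integral ?M (\<lambda>t. ln B - (ln B - f t)) ((2 * pi) ^ 3 * ln B - V)"
    by (rule has_bochner_integral_diff[OF int2 int1])
  then have "(LINT t|?M. f t) = (2 * pi) ^ 3 * ln B - V"
    by (simp add: has_bochner_integral_iff)
  then show ?thesis
    unfolding mahler_measure_def eval f_def[symmetric]
    by (simp add: f_def diff_divide_distrib)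
qed

section \<open>The Mahler measure\<close>

text \<open>The vectors \<open>1 + cis u\<close> and \<open>1 - cis u\<close> are orthogonal legs of a right triangle with hypotenuse
  2, which gives the constant term \<open>4\<close>; turning the second one by \<open>v\<close> adds twice their inner
  product, \<open>4 * sin u * sin v\<close>.\<close>

lemma norm_y_free_part:
  "(cmod (1 + cis u + (1 - cis u) * cis v))\<^sup>2 = 4 * (1 + sin u * sin v)"
proof -
  have "(cmod (1 + cis u + (1 - cis u) * cis v))\<^sup>2 =
      (1 + cos u + cos v - cos u * cos v + sin u * sin v)\<^sup>2 + (sin u + sin v - sin u * cos v - cos u * sin v)\<^sup>2"
    by (simp add: cmod_power2 algebra_simps)
  also have "\<dots> = 4 * (1 + sin u * sin v)"
    using sin_cos_squared_add[of u] sin_cos_squared_add[of v] by algebra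
  finally show ?thesis .
qed

text \<open>The excluded angles are those at which both coefficients have modulus 2, the boundary case of
  Jensen's formula; they form a null set.\<close>

lemma integral_over_y_has_integral:
  assumes "sin u \<noteq> 0" "sin v \<noteq> 0"
  shows "((\<lambda>y. ln 8 - ln (cmod (1 + cis u + (1 - cis u) * cis v + 2 * cis u * cis y))) has_integral
     2 * pi * (2 * ln 2 - ln (1 + max 0 (sin u * sin v)) / 2)) {0..2 * pi}"
proof -
  define s where "s = sin u * sin v"
  define r where "r = cmod (1 + cis u + (1 - cis u) * cis v)"
  have r2: "r\<^sup>2 = 4 * (1 + s)" by (simp add: r_def s_def norm_y_free_part)
  have "s \<noteq> 0" using assms by (simp add: s_def)
  then have "r \<noteq> 2" using r2 by auto
  have max2: "(max r 2)\<^sup>2 = 4 * (1 + max 0 s)"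
  proof (cases "r \<le> 2")
    case True
    then have "r\<^sup>2 \<le> 2\<^sup>2" by (intro power_mono) (auto simp: r_def)
    with True r2 show ?thesis by simp
  next
    case False
    then have "2\<^sup>2 \<le> r\<^sup>2" by (intro power_mono) auto
    with False r2 show ?thesis by simp
  qed
  have "ln (max r 2) = ln ((max r 2)\<^sup>2) / 2" by (subst ln_realpow) auto
  also have "\<dots> = ln (4 * (1 + max 0 s)) / 2" by (simp only: max2)
  also have "\<dots> = ln 2 + ln (1 + max 0 s) / 2"
  proof -
    have "ln (4 :: real) = 2 * ln 2" using ln_realpow[of "2 :: real" 2] by simp
    moreover have "ln (4 * (1 + max 0 s)) = ln 4 + ln (1 + max 0 s)" by (subst ln_mult) auto
    ultimately show ?thesis by (simp add: add_divide_distrib)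
  qed
  finally have ln_max: "ln (max r 2) = ln 2 + ln (1 + max 0 s) / 2" .
  have "((\<lambda>y. ln (cmod (1 + cis u + (1 - cis u) * cis v + 2 * cis u * cis y))) has_integral 2 * pi * ln (max r 2)) {0..2 * pi}"
    using Jensen_linear[of "1 + cis u + (1 - cis u) * cis v" "2 * cis u"] \<open>r \<noteq> 2\<close>
    by (simp add: r_def norm_mult)
  from has_integral_diff[OF has_integral_const_real[of "ln 8"] this]
  have "((\<lambda>y. ln 8 - ln (cmod (1 + cis u + (1 - cis u) * cis v + 2 * cis u * cis y))) has_integral
      2 * pi * ln 8 - 2 * pi * ln (max r 2)) {0..2 * pi}" by simp
  moreover have "ln (8 :: real) = 3 * ln 2" using ln_realpow[of "2 :: real" 3] by simp
  ultimately show ?thesis by (simp add: ln_max s_def algebra_simps)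
qed

lemma norm_polynomial_le:
  "cmod (1 + cis u + (1 - cis u) * cis v + 2 * cis u * cis y) \<le> 8"
proof -
  have "cmod (1 + cis u + (1 - cis u) * cis v + 2 * cis u * cis y) \<le>
      cmod (1 + cis u) + cmod ((1 - cis u) * cis v) + cmod (2 * cis u * cis y)"
    by (meson norm_triangle_ineq norm_triangle_mono order_refl)
  moreover have "cmod (1 + cis u) \<le> 2" "cmod (1 - cis u) \<le> 2"
    using norm_triangle_ineq[of 1 "cis u"] norm_triangle_ineq4[of 1 "cis u"] by simp_all
  ultimately show ?thesis by (simp add: norm_mult)
qed

text \<open>The integrations over \<open>y\<close>, \<open>v\<close> and \<open>u\<close> are, in this order, Jensen's formula, the definition of
  \<^const>\<open>ln_cos_integral\<close> and the double integral computed above.  The bound 8 on the modulus is a power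
  of 2, so that its logarithm combines with the \<open>ln 2\<close> that Jensen's formula produces.\<close>

lemma torus_integral:
  "(\<integral>\<^sup>+ u. \<integral>\<^sup>+ v. \<integral>\<^sup>+ y.
      ennreal (ln 8 - ln (cmod (1 + cis u + (1 - cis u) * cis v + 2 * cis u * cis y)))
      \<partial>circle_angle \<partial>circle_angle \<partial>circle_angle) =
    ennreal (16 * pi ^ 3 * ln 2 - 2 * pi * (8 * cal_L31_at_1 - 2 * pi\<^sup>2 * ln 2))"
proof -
  let ?K = "8 * cal_L31_at_1 - 2 * pi\<^sup>2 * ln 2"
  have inner: "(\<integral>\<^sup>+ y. ennreal (ln 8 - ln (cmod (1 + cis u + (1 - cis u) * cis v + 2 * cis u * cis y))) \<partial>circle_angle)
      = ennreal (2 * pi * (2 * ln 2 - ln (1 + max 0 (sin u * sin v)) / 2))"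
    if "sin u \<noteq> 0" "sin v \<noteq> 0" for u v
  proof (rule nn_integral_circle_angle[OF integral_over_y_has_integral[OF that]])
    fix y show "0 \<le> ln 8 - ln (cmod (1 + cis u + (1 - cis u) * cis v + 2 * cis u * cis y))"
      using norm_polynomial_le[of u v y]
      by (cases "1 + cis u + (1 - cis u) * cis v + 2 * cis u * cis y = 0") auto
  qed
  have middle: "(\<integral>\<^sup>+ v. \<integral>\<^sup>+ y. ennreal (ln 8 - ln (cmod (1 + cis u + (1 - cis u) * cis v + 2 * cis u * cis y)))
      \<partial>circle_angle \<partial>circle_angle) = ennreal (2 * pi * (4 * pi * ln 2 - ln_cos_integral \<bar>sin u\<bar> / 2))"
    if u: "sin u \<noteq> 0" for u
  proof -
    have "(\<integral>\<^sup>+ v. \<integral>\<^sup>+ y. ennreal (ln 8 - ln (cmod (1 + cis u + (1 - cis u) * cis v + 2 * cis u * cis y)))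
        \<partial>circle_angle \<partial>circle_angle) =
        (\<integral>\<^sup>+ v. ennreal (2 * pi * (2 * ln 2 - ln (1 + max 0 (sin u * sin v)) / 2)) \<partial>circle_angle)"
      by (rule nn_integral_cong_AE) (use AE_circle_angle_sin_nonzero in eventually_elim, rule inner[OF u])
    also have "\<dots> = ennreal (2 * pi * (4 * pi * ln 2 - ln_cos_integral \<bar>sin u\<bar> / 2))"
    proof (rule nn_integral_circle_angle)
      have "((\<lambda>v. 2 * pi * (2 * ln 2 - ln (1 + max 0 (sin u * sin v)) / 2)) has_integral
          2 * pi * (2 * pi * (2 * ln 2) - ln_cos_integral \<bar>sin u\<bar> / 2)) {0..2 * pi}"
        using has_integral_const_real[of "2 * ln 2 :: real" 0 "2 * pi"]
        by (intro has_integral_mult_right has_integral_diff has_integral_divide ln_positive_part_has_integral) auto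
      then show "((\<lambda>v. 2 * pi * (2 * ln 2 - ln (1 + max 0 (sin u * sin v)) / 2)) has_integral
          2 * pi * (4 * pi * ln 2 - ln_cos_integral \<bar>sin u\<bar> / 2)) {0..2 * pi}" by (simp add: mult.assoc)
      fix v
      have "\<bar>sin u * sin v\<bar> \<le> 1" unfolding abs_mult by (intro mult_le_one) auto
      then have "ln (1 + max 0 (sin u * sin v)) \<le> ln 2" by (auto simp: max_def)
      moreover have "0 < ln (2 :: real)" by simp
      ultimately have "0 \<le> 2 * ln 2 - ln (1 + max 0 (sin u * sin v)) / 2" by linarith
      then show "0 \<le> 2 * pi * (2 * ln 2 - ln (1 + max 0 (sin u * sin v)) / 2)" by simp
    qed
    finally show ?thesis .
  qed
  have "(\<integral>\<^sup>+ u. \<integral>\<^sup>+ v. \<integral>\<^sup>+ y. ennreal (ln 8 - ln (cmod (1 + cis u + (1 - cis u) * cis v + 2 * cis u * cis y)))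
      \<partial>circle_angle \<partial>circle_angle \<partial>circle_angle) =
      (\<integral>\<^sup>+ u. ennreal (2 * pi * (4 * pi * ln 2 - ln_cos_integral \<bar>sin u\<bar> / 2)) \<partial>circle_angle)"
    by (rule nn_integral_cong_AE) (use AE_circle_angle_sin_nonzero in eventually_elim, rule middle)
  also have "\<dots> = ennreal (2 * pi * (2 * pi * (4 * pi * ln 2) - 2 * ?K / 2))"
  proof (rule nn_integral_circle_angle)
    show "((\<lambda>u. 2 * pi * (4 * pi * ln 2 - ln_cos_integral \<bar>sin u\<bar> / 2)) has_integral
        2 * pi * (2 * pi * (4 * pi * ln 2) - 2 * ?K / 2)) {0..2 * pi}"
      using has_integral_const_real[of "4 * pi * ln 2 :: real" 0 "2 * pi"]
      by (intro has_integral_mult_right has_integral_diff has_integral_divide ln_cos_integral_abs_sin_has_integral) auto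
    fix u
    have "ln_cos_integral \<bar>sin u\<bar> \<le> pi * ln 2" by (intro ln_cos_integral_le) auto
    moreover have "0 < pi * ln (2 :: real)" by simp
    ultimately have "0 \<le> 4 * pi * ln 2 - ln_cos_integral \<bar>sin u\<bar> / 2" by linarith
    then show "0 \<le> 2 * pi * (4 * pi * ln 2 - ln_cos_integral \<bar>sin u\<bar> / 2)" by simp
  qed
  also have "2 * pi * (2 * pi * (4 * pi * ln 2) - 2 * ?K / 2) = 16 * pi ^ 3 * ln 2 - 2 * pi * ?K"
    by (simp add: field_simps power3_eq_cube power2_eq_square)
  finally show ?thesis .
qed

theorem theorem20:
  shows "let w = var 1 :: 3 cpoly; x = var 2; y = var 3 in
    pi\<^sup>2 * mahler_measure ((1 + w) * (1 + y) + (1 - w) * (x - y)) =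
      2 * cal_L31_at_1 + pi\<^sup>2 / 2 * ln 2"
proof -
  define K where "K = 8 * cal_L31_at_1 - 2 * pi\<^sup>2 * ln 2"
  define V where "V = 16 * pi ^ 3 * ln 2 - 2 * pi * K"
  let ?p = "\<lambda>u v y. 1 + cis u + (1 - cis u) * cis v + 2 * cis u * cis y"
  have "0 \<le> V"
  proof -
    have "K \<le> pi * (pi * ln 2)"
      using has_integral_le[OF ln_cos_integral_abs_sin_has_integral has_integral_const_real[of "pi * ln 2"]] ln_cos_integral_le
      by (simp add: K_def)
    moreover have "0 \<le> pi * (pi * ln 2)" by simp
    ultimately have "0 \<le> 16 * (pi * (pi * ln 2)) - 2 * K" by linarith
    then have "0 \<le> pi * (16 * (pi * (pi * ln 2)) - 2 * K)" by (intro mult_nonneg_nonneg) auto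
    then show ?thesis by (simp add: V_def power3_eq_cube algebra_simps)
  qed
  have "mahler_measure ((1 + var 1) * (1 + var 3) + (1 - var 1) * (var 2 - var 3) :: 3 cpoly) = ln 8 - V / (2 * pi) ^ 3"
  proof (rule mahler_measure_3_eq[where p = ?p])
    have [measurable]: "cis \<in> borel_measurable borel"
      by (intro borel_measurable_continuous_onI continuous_intros)
    show "(\<lambda>(u, v, y). ?p u v y) \<in> borel_measurable (borel \<Otimes>\<^sub>M borel \<Otimes>\<^sub>M borel)"
      by measurable
  qed (use torus_integral \<open>0 \<le> V\<close> norm_polynomial_le in \<open>simp_all add: eval_linear_in_y V_def K_def\<close>)
  moreover have "ln (8 :: real) = 3 * ln 2" using ln_realpow[of "2 :: real" 3] by simp
  moreover have "V / (2 * pi) ^ 3 = 2 * ln 2 - K / (4 * pi\<^sup>2)"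
    by (simp add: V_def field_simps power2_eq_square power3_eq_cube)
  ultimately have "mahler_measure ((1 + var 1) * (1 + var 3) + (1 - var 1) * (var 2 - var 3) :: 3 cpoly) =
      ln 2 + K / (4 * pi\<^sup>2)"
    by simp
  moreover have "pi\<^sup>2 * (ln 2 + K / (4 * pi\<^sup>2)) = 2 * cal_L31_at_1 + pi\<^sup>2 / 2 * ln 2"
    by (simp add: K_def field_simps)
  ultimately show ?thesis by (simp only: Let_def)
qed

end
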